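(* Let $q$ be a prime power and let $n$ be an integer with $2\leqslant n\leqslant q+2$. Then the entries $m_{a,b}$ of the matrix $M(0,n,q)$ satisfy: (1) $m_{a,1}=1$ for $1\leqslant a\leqslant n$; (2) $m_{a,b}=0$ for $1\leqslant a\leqslant n-2$, $2\leqslant b\leqslant \lceil n/2\rceil$ (that is, $b\leqslant \frac n2$ if $n$ is even and $b\leqslant\frac{n+1}{2}$ if $n$ is odd) and $b<n+1-a$. That is, $M(0,n,q)$ is the matrix whose first column is $(1,1,\dots,1,1)^{T}$, whose last column is $(0,-1,\dots,-1,0)^{T}$ (entries $m_{1,n}=m_{n,n}=0$ and $m_{a,n}=-1$ for $2\leqslant a\leqslant n-1$), and in which, for $2\leqslant b\leqslant n-1$, $m_{a,b}=1$ if $a+b=n+1$ and $m_{a,b}=0$ otherwise.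
   Context: Let $q$ be a power of a prime $p$. For an integer $n\geqslant 2$, $M(0,n,q)=(m_{a,b})_{1\leqslant a,b\leqslant n}$ is the $n\times n$ matrix over $\mathbb{F}_p$ with entries (binomial coefficients reduced modulo $p$, with $\binom{x}{y}=0$ for integers $0\leqslant x<y$) $$m_{a,b}=-\left[\binom{(n-a)(q-1)}{(n-b)(q-1)}-\binom{(n-a)(q-1)}{(b-1)(q-1)}\right]\ \text{ if } a\neq b,\qquad m_{a,a}=\binom{(n-a)(q-1)}{(a-1)(q-1)}.$$ (It is the matrix of coefficients, with the powers of $t$ removed, of the Atkin operator $U_t$ acting on a block of $\Gamma_0(t)$-invariant Drinfeld cusp forms of weight $k=2+(n-1)(q-1)$.) *)

theory Defs
  imports Complex_Main "Berlekamp_Zassenhaus.Finite_Field" "Jordan_Normal_Form.Matrix"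
begin

text \<open>
  The prime field with \<open>p\<close> elements is the type \<open>'p mod_ring\<close> with
  \<open>p = CARD('p)\<close> prime, and \<open>of_nat\<close> into it is reduction modulo \<open>p\<close>.
  Row and column indices \<open>a, b\<close> are 1-based. The truncated subtractions agree with
  integer subtraction, since the entry is only used for \<open>1 \<le> a, b \<le> n\<close>
  and \<open>q \<ge> 1\<close>.
\<close>

definition atkin_entry :: "nat \<Rightarrow> nat \<Rightarrow> nat \<Rightarrow> nat \<Rightarrow> 'p::prime_card mod_ring" where
  "atkin_entry n q a b =
    (if a = b then of_nat (((n - a) * (q - 1)) choose ((a - 1) * (q - 1)))
     else - (of_nat (((n - a) * (q - 1)) choose ((n - b) * (q - 1)))
             - of_nat (((n - a) * (q - 1)) choose ((b - 1) * (q - 1)))))"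

text \<open>
  The matrix \<open>M(0,n,q)\<close>; the matrix library indexes from 0, so the
  entry \<open>m\<^sub>a\<^sub>,\<^sub>b\<close> sits at position \<open>(a - 1, b - 1)\<close>.
\<close>

definition atkin_matrix :: "nat \<Rightarrow> nat \<Rightarrow> 'p::prime_card mod_ring mat" where
  "atkin_matrix n q = mat n n (\<lambda>(i, j). atkin_entry n q (i + 1) (j + 1))"

end

theory Submission
  imports Defs
begin

text \<open>
  The products \<open>i (q - 1)\<close> and \<open>j (q - 1)\<close> with \<open>1 \<le> i, j \<le> q\<close> have base-\<open>q\<close> digits
  \<open>(i - 1, q - i)\<close> and \<open>(j - 1, q - j)\<close>. By Lucas' theorem the binomial coefficient of the two
  products is \<open>(i - 1 choose j - 1) (q - i choose q - j)\<close> modulo \<open>p\<close>, and since the first factor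
  needs \<open>j \<le> i\<close> and the second \<open>i \<le> j\<close>, it is 1 for \<open>i = j\<close> and 0 otherwise.
  The only other row that occurs is \<open>i = q + 1\<close> (for \<open>n = q + 2\<close>, \<open>a = 1\<close>). There both digits of
  \<open>q\<^sup>2 - 1\<close> are \<open>q - 1\<close>, so Lucas' theorem gives the square of \<open>(q - 1 choose j - 1) = \<plusminus>1\<close>,
  and the two binomial coefficients in an entry cancel.
\<close>

text \<open>By Frobenius, (x + 1)^(N + q) = (x + 1)^N (x^q + 1); compare coefficients of
  x^k.\<close>

lemma binomial_add_prime_power:
  assumes p: "prime CHAR('a::comm_ring_1)" and q: "q = CHAR('a) ^ r"
  shows "(of_nat ((N + q) choose k) :: 'a) =
    of_nat (N choose k) + (if q \<le> k then of_nat (N choose (k - q)) else 0)"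
proof -
  let ?x = "[:0, 1::'a:]"
  have coeff: "coeff ((?x + 1) ^ m) i = of_nat (m choose i)" for m i
    by (cases "i \<le> m")
      (simp_all add: one_pCons coeff_linear_poly_power coeff_eq_0 degree_linear_power binomial_eq_0)
  have "(?x + 1) ^ q = ?x ^ q + 1"
    using freshmans_dream'[of q r ?x 1] p q by simp
  hence "(?x + 1) ^ (N + q) = (?x + 1) ^ N + monom 1 q * (?x + 1) ^ N"
    by (simp add: power_add algebra_simps monom_altdef)
  hence "coeff ((?x + 1) ^ (N + q)) k = coeff ((?x + 1) ^ N + monom 1 q * (?x + 1) ^ N) k"
    by (rule arg_cong)
  thus ?thesis
    by (simp only: coeff_add coeff coeff_monom_mult) auto
qed

text \<open>Induction on the leading part \<open>m\<close>: adding \<open>q\<close> to the upper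
  argument gives a two-term recursion, which is Pascal's rule in \<open>m\<close> and
  \<open>c\<close>.\<close>

lemma lucas_prime_power:
  assumes p: "prime CHAR('a::comm_ring_1)" and q: "q = CHAR('a) ^ r"
    and s: "s < q" and d: "d < q"
  shows "(of_nat ((m * q + s) choose (c * q + d)) :: 'a) =
    of_nat (m choose c) * of_nat (s choose d)"
proof (induction m arbitrary: c)
  case 0
  show ?case
  proof (cases c)
    case (Suc c')
    hence "s < c * q + d" using s by simp
    thus ?thesis using Suc by (simp add: binomial_eq_0)
  qed simp
next
  case (Suc m)
  have step: "(of_nat ((Suc m * q + s) choose k) :: 'a) = of_nat ((m * q + s) choose k) +
      (if q \<le> k then of_nat ((m * q + s) choose (k - q)) else 0)" for k
    using binomial_add_prime_power[OF p q, of "m * q + s" k] by (simp add: add_ac)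
  show ?case
  proof (cases c)
    case 0
    thus ?thesis using step[of d] Suc.IH[of 0] d by simp
  next
    case (Suc c')
    have "c * q + d - q = c' * q + d" "q \<le> c * q + d"
      using Suc by simp_all
    thus ?thesis
      using step[of "c * q + d"] Suc.IH[of c] Suc.IH[of c'] Suc by (simp add: algebra_simps)
  qed
qed

text \<open>Row \<open>q\<close> of Pascal's triangle vanishes strictly between its ends, so
  neighbours in row \<open>q - 1\<close> are negatives of each other.\<close>

lemma binomial_pred_prime_power:
  assumes p: "prime CHAR('a::comm_ring_1)" and q: "q = CHAR('a) ^ r" and k: "k < q"
  shows "(of_nat ((q - 1) choose k) :: 'a) = (- 1) ^ k"
  using k
proof (induction k)
  case (Suc k)
  obtain q' where q': "q = Suc q'" using Suc.prems by (cases q) auto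
  have "(of_nat (q choose Suc k) :: 'a) = 0"
    using binomial_add_prime_power[OF p q, of 0 "Suc k"] Suc.prems by simp
  hence "(of_nat (q' choose k) :: 'a) + of_nat (q' choose Suc k) = 0"
    by (simp add: q')
  thus ?case using Suc q' by (simp add: add_eq_0_iff)
qed simp

lemma binomial_multiples_pred:
  assumes p: "prime CHAR('a::comm_ring_1)" and q: "q = CHAR('a) ^ r"
    and q1: "1 < q" and i: "i \<le> q" and j: "1 \<le> j"
  shows "(of_nat ((i * (q - 1)) choose (j * (q - 1))) :: 'a) = (if i = j then 1 else 0)"
proof (cases "1 \<le> i \<and> j \<le> i")
  case True
  have digits: "k * (q - 1) = (k - 1) * q + (q - k)" if "1 \<le> k" "k \<le> q" for k
    using that by (cases k; cases q) (auto simp: algebra_simps)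
  have "(of_nat ((i * (q - 1)) choose (j * (q - 1))) :: 'a) =
      of_nat ((i - 1) choose (j - 1)) * of_nat ((q - i) choose (q - j))"
    unfolding digits[of i, OF conjunct1[OF True] i] digits[of j, OF j le_trans[OF conjunct2[OF True] i]]
    by (rule lucas_prime_power[OF p q]) (use True i j in auto)
  moreover have "q - i < q - j" if "i \<noteq> j"
    using True i that by linarith
  ultimately show ?thesis by (auto simp: binomial_eq_0)
next
  case False
  \<comment> \<open>Since \<open>j\<close> is positive, \<open>i = 0\<close> also gives
    \<open>i < j\<close>.\<close>
  hence "i * (q - 1) < j * (q - 1)"
    using q1 j by (intro mult_strict_right_mono) auto
  thus ?thesis using False j by (auto simp: binomial_eq_0)
qed

lemma binomial_prime_power_square_pred:
  assumes p: "prime CHAR('a::comm_ring_1)" and q: "q = CHAR('a) ^ r"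
    and j: "1 \<le> j" "j \<le> q"
  shows "(of_nat (((q + 1) * (q - 1)) choose (j * (q - 1))) :: 'a) = 1"
proof -
  have digits: "(q + 1) * (q - 1) = (q - 1) * q + (q - 1)" "j * (q - 1) = (j - 1) * q + (q - j)"
    using j by (cases j; cases q; simp add: algebra_simps)+
  have "(of_nat (((q + 1) * (q - 1)) choose (j * (q - 1))) :: 'a) =
      of_nat ((q - 1) choose (j - 1)) * of_nat ((q - 1) choose (q - j))"
    unfolding digits by (rule lucas_prime_power[OF p q]) (use j in auto)
  \<comment> \<open>Symmetry turns the product into a square, which removes the sign.\<close>
  also have "(q - 1) choose (q - j) = (q - 1) choose (j - 1)"
    using j by (subst binomial_symmetric) auto
  also have "(of_nat ((q - 1) choose (j - 1)) :: 'a) = (- 1) ^ (j - 1)"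
    using j by (intro binomial_pred_prime_power[OF p q]) auto
  finally show ?thesis by (simp flip: power_mult_distrib)
qed

theorem theorem5p6:
  fixes n q r :: nat
    and M :: "'p::prime_card mod_ring mat"
    and m :: "nat \<Rightarrow> nat \<Rightarrow> 'p mod_ring"
  assumes q: "q = CARD('p) ^ r" "r \<ge> 1"
    and n: "2 \<le> n" "n \<le> q + 2"
  defines "M \<equiv> atkin_matrix n q"
    and "m \<equiv> \<lambda>a b. M $$ (a - 1, b - 1)"
  shows "(\<forall>a. 1 \<le> a \<and> a \<le> n \<longrightarrow> m a 1 = 1) \<and>
    (\<forall>a b. 1 \<le> a \<and> a \<le> n - 2 \<and> 2 \<le> b \<and> int b \<le> \<lceil>real n / 2\<rceil> \<and> b < n + 1 - a
      \<longrightarrow> m a b = 0) \<and>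
    (\<forall>a. 1 \<le> a \<and> a \<le> n \<longrightarrow> m a n = (if a = 1 \<or> a = n then 0 else - 1)) \<and>
    (\<forall>a b. 1 \<le> a \<and> a \<le> n \<and> 2 \<le> b \<and> b \<le> n - 1
      \<longrightarrow> m a b = (if a + b = n + 1 then 1 else 0))"
proof -
  have p: "prime CHAR('p mod_ring)" using prime_card[where 'a='p] by simp
  have q': "q = CHAR('p mod_ring) ^ r" using q by simp
  have q1: "1 < q" unfolding q(1)
    using q(2) by (intro one_less_power prime_gt_1_nat prime_card) simp
  let ?C = "\<lambda>i j. of_nat ((i * (q - 1)) choose (j * (q - 1))) :: 'p mod_ring"
  have C: "?C i j = (if i = j then 1 else 0)" if "i \<le> q" "1 \<le> j" for i j
    using binomial_multiples_pred[OF p q' q1 that] .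
  have C_top: "?C (q + 1) j = 1" if "1 \<le> j" "j \<le> q" for j
    using binomial_prime_power_square_pred[OF p q' that] .
  have C_less: "?C i j = 0" if "i < j" for i j
    using that q1 by (simp add: binomial_eq_0)
  have m: "m a b = (if a = b then ?C (n - a) (a - 1) else - (?C (n - a) (n - b) - ?C (n - a) (b - 1)))"
    if "1 \<le> a" "a \<le> n" "1 \<le> b" "b \<le> n" for a b
    using that by (auto simp: m_def M_def atkin_matrix_def atkin_entry_def)
  \<comment> \<open>In the first and last columns the only lower indices of \<open>?C\<close> are
    \<open>0\<close> and \<open>n - 1\<close>, and \<open>n - 1\<close> exceeds \<open>n - a\<close>
    unless \<open>a = 1\<close>.\<close>
  have first: "m a 1 = 1" if "1 \<le> a" "a \<le> n" for a
    using that n C_less[of "n - a" "n - 1"] by (cases "a = 1") (simp_all add: m)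
  have last: "m a n = (if a = 1 \<or> a = n then 0 else - 1)" if "1 \<le> a" "a \<le> n" for a
    using that n C_less[of "n - a" "n - 1"] by (cases "a = 1"; cases "a = n") (simp_all add: m)
  have middle: "m a b = (if a + b = n + 1 then 1 else 0)"
    if "1 \<le> a" "a \<le> n" "2 \<le> b" "b \<le> n - 1" for a b
  proof (cases "n - a \<le> q")
    case True
    \<comment> \<open>This term is nonzero only on the diagonal, where the entry omits it; the other
      term yields the antidiagonal.\<close>
    have "?C (n - a) (n - b) = (if a = b then 1 else 0)"
      using C[OF True, of "n - b"] that by auto
    moreover have "?C (n - a) (b - 1) = (if a + b = n + 1 then 1 else 0)"
      using C[OF True, of "b - 1"] that by auto
    ultimately show ?thesis using that by (cases "a = b") (simp_all add: m)
  next
    case False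
    \<comment> \<open>In this row \<open>n - b\<close> and \<open>b - 1\<close> both lie between 1
      and \<open>q\<close>, so the entry is -(1 - 1); the antidiagonal would require
      \<open>b = n\<close>.\<close>
    hence "a = 1" "n = q + 2" using that n by auto
    thus ?thesis using that C_top[of "n - b"] C_top[of "b - 1"] by (simp add: m)
  qed
  have upper: "m a b = 0"
    if "1 \<le> a" "a \<le> n - 2" "2 \<le> b" "int b \<le> \<lceil>real n / 2\<rceil>" "b < n + 1 - a" for a b
  proof -
    \<comment> \<open>The bound \<open>b < n + 1 - a\<close> excludes both the last column and the
      antidiagonal.\<close>
    have "b \<le> n - 1" using that by linarith
    thus ?thesis using middle[of a b] that by simp
  qed
  show ?thesis using first last middle upper by blast
qed

end
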